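(* Let $\mathrm{k}$ be a field of characteristic zero, $\mathcal{A}$ an associative (not necessarily commutative) unital $\mathrm{k}$-algebra, $\mathcal{M}$ a unital $\mathcal{A}$-bimodule, and let $E,H\in\mathcal{A}$ and $c\in\mathrm{k}$ satisfy $[H,E]=HE-EH=cE$. If $p\in\mathcal{M}[t]$ satisfies $$E^np(H+n)=p(H-n)E^n\quad\text{for } n=1,\dots,\deg(p)+1,$$ then $E^np(H+n)=p(H-n)E^n$ holds for all $n\ge0$.
   Context: $\mathcal{M}[t]=\mathcal{M}\otimes_{\mathrm{k}}\mathrm{k}[t]$. For $p=p_0+p_1t+\dots+p_dt^d\in\mathcal{M}[t]$ and $r\in\mathcal{A}$, evaluation uses the right action of $\mathcal{A}$ on $\mathcal{M}$: $p(r)=p_0+p_1r+\dots+p_dr^d\in\mathcal{M}$. *)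

theory Defs
  imports "HOL-Computational_Algebra.Polynomial"
begin

(* The sort {ring, monoid_mult} is ring_1 without 0 \<noteq> 1, so the zero algebra is included. *)
locale unital_algebra = vector_space scale
  for scale :: "'k::field \<Rightarrow> 'a::{ring, monoid_mult} \<Rightarrow> 'a" +
  assumes scale_mult_left: "scale c x * y = scale c (x * y)"
    and mult_scale_right: "x * scale c y = scale c (x * y)"

(* Bimodules over a k-algebra are k-central: the k-vector space structures on M coming from
   the left and the right action coincide (bimodule_central). *)
locale unital_bimodule = unital_algebra scale
  for scale :: "'k::field \<Rightarrow> 'a::{ring, monoid_mult} \<Rightarrow> 'a" +
  fixes lact :: "'a \<Rightarrow> 'm::ab_group_add \<Rightarrow> 'm"
    and ract :: "'m \<Rightarrow> 'a \<Rightarrow> 'm"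
  assumes lact_add_left: "lact (a + b) m = lact a m + lact b m"
    and lact_add_right: "lact a (m + m') = lact a m + lact a m'"
    and lact_mult: "lact (a * b) m = lact a (lact b m)"
    and lact_one: "lact 1 m = m"
    and ract_add_left: "ract (m + m') a = ract m a + ract m' a"
    and ract_add_right: "ract m (a + b) = ract m a + ract m b"
    and ract_mult: "ract m (a * b) = ract (ract m a) b"
    and ract_one: "ract m 1 = m"
    and bimodule_assoc: "ract (lact a m) b = lact a (ract m b)"
    and bimodule_central: "lact (scale c 1) m = ract m (scale c 1)"

(* M[t] is the type 'm poly, i.e. finitely supported coefficient sequences in M. *)
definition right_eval :: "('m::ab_group_add \<Rightarrow> 'a::{ring, monoid_mult} \<Rightarrow> 'm) \<Rightarrow> 'm poly \<Rightarrow> 'a \<Rightarrow> 'm"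
  where "right_eval ract p r = (\<Sum>i\<le>degree p. ract (coeff p i) (r ^ i))"

end

theory Submission
  imports Defs
begin

text \<open>
  Let \<open>L\<close> and \<open>R\<close> be the commuting actions of \<open>E\<close> on \<open>M\<close> from the left and the right, let
  \<open>D = deg p + 1\<close> and \<open>N > D\<close>, and put \<open>n = N - a - b\<close> for \<open>0 \<le> a, b \<le> D\<close>. Weighted with
  \<open>(-1) ^ (a + b) (D choose a) (D choose b)\<close>, the elements
  \<open>L ^ (N - b) R ^ b p(H + n) - L ^ a R ^ (N - a) p(H - n)\<close> add up to zero: for fixed \<open>b\<close> in the
  first term, and for fixed \<open>a\<close> in the second, one meets a \<open>D\<close>-th difference of a polynomial of
  degree less than \<open>D\<close>. Up to sign each element is a multiple of the relation with index \<open>\<bar>n\<bar>\<close>,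
  and \<open>\<bar>n\<bar> < N\<close> except at \<open>a = b = 0\<close>, so the relation with index \<open>N\<close> follows from the earlier ones.
\<close>

context unital_algebra
begin

text \<open>Induction on \<open>i\<close>: splitting off one factor \<open>x - k s\<close> leaves a
  sum that vanishes by induction and one with an extra factor \<open>k\<close>. The identity
  \<open>k (n choose k) = n (n - 1 choose k - 1)\<close> absorbs that factor, giving a difference of
  order \<open>n - 1\<close> based at \<open>x - s\<close>.\<close>

lemma alternating_binomial_sum_power:
  assumes "i < n"
  shows "(\<Sum>k\<le>n. scale ((-1) ^ k * of_nat (n choose k)) ((x - scale (of_nat k * s) 1) ^ i)) = 0"
  using assms
proof (induction i arbitrary: n x)
  case 0
  have "(\<Sum>k\<le>n. scale ((-1) ^ k * of_nat (n choose k)) 1) =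
      scale (\<Sum>k\<le>n. (-1) ^ k * of_nat (n choose k)) 1"
    by (rule scale_sum_left [symmetric])
  then show ?case
    using choose_alternating_sum [of n, where 'a = 'k] 0 by simp
next
  case (Suc i)
  then obtain m where n: "n = Suc m" and "i < m"
    by (cases n) auto
  define w :: "nat \<Rightarrow> nat \<Rightarrow> 'k" where "w n k = (-1) ^ k * of_nat (n choose k)" for n k
  define y where "y x k = x - scale (of_nat k * s) 1" for x k
  have IH: "(\<Sum>k\<le>n. scale (w n k) (y x k ^ i)) = 0" if "i < n" for n x
    using Suc.IH [OF that] by (simp add: w_def y_def)
  have absorb: "w (Suc m) (Suc k) * (of_nat (Suc k) * s) = - (of_nat (Suc m) * s) * w m k" for k
  proof -
    have "of_nat (Suc k) * of_nat (Suc m choose Suc k) = (of_nat (Suc m) * of_nat (m choose k) :: 'k)"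
      by (metis Suc_times_binomial of_nat_mult)
    then show ?thesis
      by (simp add: w_def ac_simps del: of_nat_Suc binomial_Suc_Suc)
  qed
  have shift: "y x (Suc k) = y (x - scale s 1) k" for k
    by (simp add: y_def algebra_simps scale_left_distrib)
  have "(\<Sum>k\<le>n. scale (w n k) (y x k ^ Suc i)) =
      (\<Sum>k\<le>n. scale (w n k) (y x k ^ i)) * x - (\<Sum>k\<le>n. scale (w n k * (of_nat k * s)) (y x k ^ i))"
  proof -
    have "scale (w n k) (y x k ^ Suc i) =
        scale (w n k) (y x k ^ i) * x - scale (w n k * (of_nat k * s)) (y x k ^ i)" for k
    proof -
      have "y x k ^ Suc i = y x k ^ i * x - scale (of_nat k * s) (y x k ^ i)"
        unfolding power_Suc2 by (subst (2) y_def) (simp add: right_diff_distrib mult_scale_right)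
      then show ?thesis
        by (simp add: scale_right_diff_distrib scale_mult_left del: power_Suc)
    qed
    then show ?thesis
      by (simp add: sum_subtractf sum_distrib_right del: power_Suc)
  qed
  also have "(\<Sum>k\<le>n. scale (w n k) (y x k ^ i)) = 0"
    using IH [of n] \<open>i < m\<close> n by simp
  \<comment> \<open>The term \<open>k = 0\<close> drops out through its factor \<open>k\<close>; the
    others are reindexed.\<close>
  also have "(\<Sum>k\<le>n. scale (w n k * (of_nat k * s)) (y x k ^ i)) =
      scale (- (of_nat (Suc m) * s)) (\<Sum>k\<le>m. scale (w m k) (y (x - scale s 1) k ^ i))"
    unfolding n sum.atMost_Suc_shift absorb shift scale_sum_right by simp
  also have "\<dots> = 0"
    using IH [OF \<open>i < m\<close>] by simp
  finally show ?case
    by (simp add: w_def y_def)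
qed

end

context unital_bimodule
begin

lemma additive_lact: "additive (lact a)"
  by unfold_locales (rule lact_add_right)

lemma additive_ract_left: "additive (\<lambda>m. ract m a)"
  by unfold_locales (rule ract_add_left)

lemma additive_ract_right: "additive (ract m)"
  by unfold_locales (rule ract_add_right)

lemmas lact_zero = additive.zero [OF additive_lact]
lemmas lact_diff = additive.diff [OF additive_lact]
lemmas lact_sum = additive.sum [OF additive_lact]
lemmas ract_zero_left = additive.zero [OF additive_ract_left]
lemmas ract_diff_left = additive.diff [OF additive_ract_left]
lemmas ract_sum_left = additive.sum [OF additive_ract_left]
lemmas ract_zero_right = additive.zero [OF additive_ract_right]
lemmas ract_sum_right = additive.sum [OF additive_ract_right]

text \<open>\<open>M\<close> carries no scalar multiplication of its own, so scalars act on it as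
  \<open>scale k 1\<close> from the right.\<close>

lemma ract_scale: "ract m (scale k a) = ract (ract m a) (scale k 1)"
  by (metis mult_1_right mult_scale_right ract_mult)

lemma ract_scale_commute: "ract (ract m (scale k 1)) a = ract (ract m a) (scale k 1)"
  by (metis mult_1_left ract_mult ract_scale scale_mult_left)

lemma alternating_binomial_sum_right_eval:
  assumes "degree p < n"
  shows "(\<Sum>k\<le>n. ract (right_eval ract p (x - scale (of_nat k * s) 1))
                       (scale ((-1) ^ k * of_nat (n choose k)) 1)) = 0"
proof -
  have "(\<Sum>k\<le>n. ract (right_eval ract p (x - scale (of_nat k * s) 1))
                       (scale ((-1) ^ k * of_nat (n choose k)) 1)) =
      (\<Sum>k\<le>n. \<Sum>i\<le>degree p. ract (coeff p i)
         (scale ((-1) ^ k * of_nat (n choose k)) ((x - scale (of_nat k * s) 1) ^ i)))"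
    unfolding right_eval_def ract_sum_left
    by (intro sum.cong refl) (rule ract_scale [symmetric])
  also have "\<dots> = (\<Sum>i\<le>degree p. ract (coeff p i)
      (\<Sum>k\<le>n. scale ((-1) ^ k * of_nat (n choose k)) ((x - scale (of_nat k * s) 1) ^ i)))"
    unfolding ract_sum_right by (rule sum.swap)
  also have "\<dots> = 0"
    using assms by (simp add: alternating_binomial_sum_power ract_zero_right)
  finally show ?thesis .
qed

lemma lact_power_right_eval_eq_ract_power:
  assumes hyp: "\<And>n. 1 \<le> n \<Longrightarrow> n \<le> degree p + 1 \<Longrightarrow>
      lact (E ^ n) (right_eval ract p (H + scale (of_nat n) 1)) =
      ract (right_eval ract p (H - scale (of_nat n) 1)) (E ^ n)"
  shows "lact (E ^ N) (right_eval ract p (H + scale (of_nat N) 1)) =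
      ract (right_eval ract p (H - scale (of_nat N) 1)) (E ^ N)"
proof (induction N rule: less_induct)
  case (less N)
  define D where "D = degree p + 1"
  \<comment> \<open>A scalar argument allows negative shifts, so both sides of a relation are values
    of \<open>P\<close>.\<close>
  define P where "P z = right_eval ract p (H + scale z 1)" for z
  have eq_neg: "right_eval ract p (H - scale z 1) = P (- z)" for z
    by (simp add: P_def)
  have IH: "lact (E ^ n) (P (of_nat n)) = ract (P (- of_nat n)) (E ^ n)" if "n < N" for n
    using less.IH [OF that] by (simp only: eq_neg flip: P_def)
  consider "N = 0" | "1 \<le> N" "N \<le> D" | "D < N"
    by linarith
  then show ?case
  proof cases
    case 1
    then show ?thesis
      by (simp add: lact_one ract_one)
  next
    case 2
    then show ?thesis
      using hyp by (simp add: D_def)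
  next
    case 3
    define w :: "nat \<Rightarrow> 'k" where "w k = (-1) ^ k * of_nat (D choose k)" for k
    define z :: "nat \<Rightarrow> nat \<Rightarrow> 'k" where "z a b = of_nat N - of_nat a - of_nat b" for a b
    define X where "X a b = lact (E ^ (N - b)) (ract (P (z a b)) (E ^ b))" for a b
    define Y where "Y a b = lact (E ^ a) (ract (P (- z a b)) (E ^ (N - a)))" for a b
    \<comment> \<open>For \<open>n = N - a - b \<ge> 0\<close> the difference \<open>X a b - Y a b\<close> is the \<open>n\<close>-th relation multiplied
      by \<open>E ^ a\<close> and \<open>E ^ b\<close>; for \<open>n < 0\<close> it is minus the \<open>(-n)\<close>-th relation multiplied by
      \<open>E ^ (N - b)\<close> and \<open>E ^ (N - a)\<close>.\<close>
    have XY: "X a b = Y a b" if "a \<le> D" "b \<le> D" "a + b \<noteq> 0" for a b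
    proof (cases "a + b \<le> N")
      case True
      define n where "n = N - a - b"
      have n: "N - b = a + n" "N - a = n + b" "z a b = of_nat n" "n < N"
        using True that by (auto simp: n_def z_def of_nat_diff)
      show ?thesis
        using IH [OF \<open>n < N\<close>]
        by (simp add: X_def Y_def n power_add lact_mult ract_mult flip: bimodule_assoc)
    next
      case False
      define n where "n = a + b - N"
      \<comment> \<open>Since \<open>a, b \<le> D < N\<close>, no subtraction here is truncated and
        \<open>n < N\<close>.\<close>
      have n: "a = N - b + n" "b = n + (N - a)" "n < N"
        using False that 3 by (auto simp: n_def)
      have zn: "z a b = - of_nat n"
        using False by (simp add: n_def z_def of_nat_diff)
      have "X a b = lact (E ^ (N - b)) (ract (P (- of_nat n)) (E ^ (n + (N - a))))"
        using n(2) zn by (simp add: X_def)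
      also have "\<dots> = lact (E ^ (N - b + n)) (ract (P (of_nat n)) (E ^ (N - a)))"
        using IH [OF \<open>n < N\<close>]
        by (simp add: power_add lact_mult ract_mult flip: bimodule_assoc)
      also have "\<dots> = Y a b"
        using n(1) zn by (simp add: Y_def)
      finally show ?thesis .
    qed
    have "(\<Sum>a\<le>D. ract (X a b) (scale (w a) 1)) = 0" for b
    proof -
      have "(\<Sum>a\<le>D. ract (P (z a b)) (scale (w a) 1)) = 0"
        using alternating_binomial_sum_right_eval [of p D "H + scale (of_nat N - of_nat b) 1" 1]
        by (simp add: D_def P_def w_def z_def scale_left_diff_distrib algebra_simps)
      moreover have "(\<Sum>a\<le>D. ract (X a b) (scale (w a) 1)) =
          lact (E ^ (N - b)) (ract (\<Sum>a\<le>D. ract (P (z a b)) (scale (w a) 1)) (E ^ b))"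
        by (simp add: X_def lact_sum ract_sum_left bimodule_assoc ract_scale_commute)
      ultimately show ?thesis
        by (simp add: lact_zero ract_zero_left)
    qed
    then have X0: "(\<Sum>b\<le>D. ract (\<Sum>a\<le>D. ract (X a b) (scale (w a) 1)) (scale (w b) 1)) = 0"
      by (simp add: ract_zero_left)
    have "(\<Sum>b\<le>D. ract (Y a b) (scale (w b) 1)) = 0" for a
    proof -
      \<comment> \<open>As \<open>- z a b = b - (N - a)\<close>, the shift grows with
        \<open>b\<close>, hence the step \<open>-1\<close>.\<close>
      have "(\<Sum>b\<le>D. ract (P (- z a b)) (scale (w b) 1)) = 0"
        using alternating_binomial_sum_right_eval [of p D "H - scale (of_nat N - of_nat a) 1" "-1"]
        by (simp add: D_def P_def w_def z_def scale_left_diff_distrib algebra_simps)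
      moreover have "(\<Sum>b\<le>D. ract (Y a b) (scale (w b) 1)) =
          lact (E ^ a) (ract (\<Sum>b\<le>D. ract (P (- z a b)) (scale (w b) 1)) (E ^ (N - a)))"
        by (simp add: Y_def lact_sum ract_sum_left bimodule_assoc ract_scale_commute)
      ultimately show ?thesis
        by (simp add: lact_zero ract_zero_left)
    qed
    then have "(\<Sum>a\<le>D. ract (\<Sum>b\<le>D. ract (Y a b) (scale (w b) 1)) (scale (w a) 1)) = 0"
      by (simp add: ract_zero_left)
    then have Y0: "(\<Sum>b\<le>D. ract (\<Sum>a\<le>D. ract (Y a b) (scale (w a) 1)) (scale (w b) 1)) = 0"
      unfolding ract_sum_left by (subst sum.swap, subst ract_scale_commute)
    have "0 = (\<Sum>b\<le>D. ract (\<Sum>a\<le>D. ract (X a b - Y a b) (scale (w a) 1)) (scale (w b) 1))"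
      using X0 Y0 by (simp add: ract_diff_left sum_subtractf)
    \<comment> \<open>By \<open>XY\<close> only \<open>a = b = 0\<close> survives, with weight
      \<open>w 0 = 1\<close> in each index.\<close>
    also have "\<dots> = (\<Sum>b\<in>{0}. ract (\<Sum>a\<le>D. ract (X a b - Y a b) (scale (w a) 1)) (scale (w b) 1))"
      by (intro sum.mono_neutral_right) (auto simp: XY ract_zero_left)
    also have "\<dots> = (\<Sum>a\<le>D. ract (X a 0 - Y a 0) (scale (w a) 1))"
      by (simp add: w_def ract_one)
    also have "\<dots> = (\<Sum>a\<in>{0}. ract (X a 0 - Y a 0) (scale (w a) 1))"
      by (intro sum.mono_neutral_right) (auto simp: XY ract_zero_left)
    also have "\<dots> = X 0 0 - Y 0 0"
      by (simp add: w_def ract_one)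
    finally have "X 0 0 = Y 0 0"
      by simp
    then show ?thesis
      unfolding eq_neg by (simp add: X_def Y_def z_def lact_one ract_one flip: P_def)
  qed
qed

end

theorem corollary2p3:
  fixes scale :: "'k::field_char_0 \<Rightarrow> 'a::{ring, monoid_mult} \<Rightarrow> 'a"
    and lact :: "'a \<Rightarrow> 'm::ab_group_add \<Rightarrow> 'm"
    and ract :: "'m \<Rightarrow> 'a \<Rightarrow> 'm"
    and E H :: 'a
    and c :: 'k
    and p :: "'m poly"
  assumes "unital_bimodule scale lact ract"
    and "H * E - E * H = scale c E"
    and "\<forall>n::nat. 1 \<le> n \<and> n \<le> degree p + 1 \<longrightarrow>
           lact (E ^ n) (right_eval ract p (H + scale (of_nat n) 1)) =
           ract (right_eval ract p (H - scale (of_nat n) 1)) (E ^ n)"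
  shows "\<forall>n::nat.
           lact (E ^ n) (right_eval ract p (H + scale (of_nat n) 1)) =
           ract (right_eval ract p (H - scale (of_nat n) 1)) (E ^ n)"
  using unital_bimodule.lact_power_right_eval_eq_ract_power [OF assms(1)] assms(3) by blast

end
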